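(* For all nonnegative integers $m,n,k$, $$\binom{m+1,\,n}{k+1}=2^{n-k-1}\binom{n}{k+1}+\sum_{i=0}^m\binom{i,\,n}{k}.$$ In particular, for $n\le k\le m+n$, $$\binom{m+1,\,n}{k+1}=\sum_{i=0}^m\binom{i,\,n}{k}.$$
   Context: For nonnegative integers $m,n,k$, let $X$ be a set that is the disjoint union of blocks $X_1,\dots,X_n,Y$ with $|X_i|=2$ for $i=1,\dots,n$ and $|Y|=m$. The number $\binom{m,n}{k}$ (two entries on top) is defined as the number of $(n+k)$-element subsets of $X$ that intersect each block $X_i$, $i=1,\dots,n$ (such subsets are called $(n+k)$-insets of $X$). The symbol $\binom{n}{k+1}$ (one entry on top) is the ordinary binomial coefficient, equal to $0$ when $k+1>n$ (so the term $2^{n-k-1}\binom{n}{k+1}$ is $0$ in that case). *)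

theory Defs
  imports "HOL-Library.Disjoint_Sets"
begin

definition block_partition :: "(nat \<Rightarrow> 'a set) \<Rightarrow> 'a set \<Rightarrow> nat \<Rightarrow> nat \<Rightarrow> bool" where
  "block_partition B Y m n \<longleftrightarrow>
     (\<forall>i\<in>{1..n}. card (B i) = 2) \<and> finite Y \<and> card Y = m \<and>
     disjoint_family_on B {1..n} \<and> (\<forall>i\<in>{1..n}. B i \<inter> Y = {})"

definition insets :: "(nat \<Rightarrow> 'a set) \<Rightarrow> 'a set \<Rightarrow> nat \<Rightarrow> nat \<Rightarrow> 'a set set" where
  "insets B Y n k =
     {S. S \<subseteq> (\<Union>i\<in>{1..n}. B i) \<union> Y \<and> card S = n + k \<and> (\<forall>i\<in>{1..n}. S \<inter> B i \<noteq> {})}"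

text \<open>The number of insets is computed in one fixed model, with blocks
  \<open>{i} \<times> {0, 1}\<close> for \<open>1 \<le> i \<le> n\<close> and \<open>Y = {0} \<times> {0, \<dots>, m - 1}\<close>.
  Lemma \<open>card_insets\<close> below shows that every other choice of blocks gives the same number.\<close>

definition inset_number :: "nat \<Rightarrow> nat \<Rightarrow> nat \<Rightarrow> nat" where
  "inset_number m n k = card (insets (\<lambda>i. {i} \<times> {..<2::nat}) ({0::nat} \<times> {..<m}) n k)"

lemma block_partition_model:
  "block_partition (\<lambda>i. {i} \<times> {..<2::nat}) ({0::nat} \<times> {..<m}) m n"
  by (auto simp: block_partition_def disjoint_family_on_def card_cartesian_product)

lemma card_insets_le:
  assumes P: "block_partition B Y m n" and P': "block_partition B' Y' m n"
  shows "card (insets B Y n k) \<le> card (insets B' Y' n k)"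
proof -
  define X where "X = (\<Union>i\<in>{1..n}. B i) \<union> Y"
  define X' where "X' = (\<Union>i\<in>{1..n}. B' i) \<union> Y'"
  have fin: "finite (B i)" "finite (B' i)" if "i \<in> {1..n}" for i
    using P P' that by (auto simp: block_partition_def intro: card_ge_0_finite)
  have "\<exists>g. bij_betw g (B i) (B' i)" if "i \<in> {1..n}" for i
    using P P' that fin[OF that] by (intro finite_same_card_bij) (auto simp: block_partition_def)
  then have "\<forall>i\<in>{1..n}. \<exists>g. bij_betw g (B i) (B' i)"
    by blast
  then obtain g where g: "\<And>i. i \<in> {1..n} \<Longrightarrow> bij_betw (g i) (B i) (B' i)"
    using bchoice[of "{1..n}" "\<lambda>i g. bij_betw g (B i) (B' i)"] by blast
  obtain h where h: "bij_betw h Y Y'"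
    using P P' finite_same_card_bij[of Y Y'] by (auto simp: block_partition_def)
  define f where "f x = (if x \<in> Y then h x else g (THE i. i \<in> {1..n} \<and> x \<in> B i) x)" for x
  have D: "\<And>i j. i \<in> {1..n} \<Longrightarrow> j \<in> {1..n} \<Longrightarrow> i \<noteq> j \<Longrightarrow> B i \<inter> B j = {}"
    using P by (simp add: block_partition_def disjoint_family_on_def)
  have Z: "\<And>i. i \<in> {1..n} \<Longrightarrow> B i \<inter> Y = {}"
    using P by (simp add: block_partition_def)
  have D': "\<And>i j. i \<in> {1..n} \<Longrightarrow> j \<in> {1..n} \<Longrightarrow> i \<noteq> j \<Longrightarrow> B' i \<inter> B' j = {}"
    using P' by (simp add: block_partition_def disjoint_family_on_def)
  have Z': "\<And>i. i \<in> {1..n} \<Longrightarrow> B' i \<inter> Y' = {}"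
    using P' by (simp add: block_partition_def)
  have fg: "f x = g i x" if "i \<in> {1..n}" "x \<in> B i" for i x
  proof -
    have u: "j = i" if "j \<in> {1..n}" "x \<in> B j" for j
      using D[OF that(1) \<open>i \<in> {1..n}\<close>] that(2) \<open>x \<in> B i\<close> by blast
    have "(THE j. j \<in> {1..n} \<and> x \<in> B j) = i"
      by (rule the_equality) (use that u in blast)+
    moreover have "x \<notin> Y"
      using Z[OF that(1)] that(2) by blast
    ultimately show ?thesis by (simp add: f_def)
  qed
  have im: "f ` B i = B' i" "inj_on f (B i)" if "i \<in> {1..n}" for i
  proof -
    have "bij_betw f (B i) (B' i)"
      using g[OF that] fg[OF that] by (subst bij_betw_cong[of _ f "g i"])
    then show "f ` B i = B' i" "inj_on f (B i)"
      by (simp_all add: bij_betw_def)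
  qed
  have imY: "f ` Y = Y'" "inj_on f Y"
  proof -
    have "bij_betw f Y Y'"
      using h by (subst bij_betw_cong[of _ f h]) (simp_all add: f_def)
    then show "f ` Y = Y'" "inj_on f Y"
      by (simp_all add: bij_betw_def)
  qed
  have inj: "inj_on f X"
  proof (rule inj_onI)
    fix x y assume xy: "x \<in> X" "y \<in> X" and eq: "f x = f y"
    consider "x \<in> Y" "y \<in> Y" | i where "i \<in> {1..n}" "x \<in> B i" "y \<in> Y"
      | i where "i \<in> {1..n}" "y \<in> B i" "x \<in> Y"
      | i j where "i \<in> {1..n}" "j \<in> {1..n}" "x \<in> B i" "y \<in> B j"
      using xy unfolding X_def by blast
    then show "x = y"
    proof cases
      case 1
      then show ?thesis using imY eq by (auto dest: inj_onD)
    next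
      case (2 i)
      then show ?thesis using im(1)[OF 2(1)] imY(1) Z'[OF 2(1)] eq by (metis IntI empty_iff imageI)
    next
      case (3 i)
      then show ?thesis using im(1)[OF 3(1)] imY(1) Z'[OF 3(1)] eq by (metis IntI empty_iff imageI)
    next
      case (4 i j)
      then have "i = j"
        using im(1)[OF 4(1)] im(1)[OF 4(2)] D'[of i j] eq by (metis IntI empty_iff imageI)
      then show ?thesis using 4 im(2)[of i] eq by (auto dest: inj_onD)
    qed
  qed
  have fX: "f ` X = X'"
    using im imY unfolding X_def X'_def by (simp add: image_Un image_UN)
  have "inj_on ((`) f) (insets B Y n k)"
    by (rule inj_on_subset[OF inj_on_image_Pow[OF inj]]) (auto simp: insets_def X_def)
  moreover have "(`) f ` insets B Y n k \<subseteq> insets B' Y' n k"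
  proof (rule image_subsetI)
    fix S assume S: "S \<in> insets B Y n k"
    then have SX: "S \<subseteq> X" by (auto simp: insets_def X_def)
    have "card (f ` S) = n + k"
      using S card_image[OF inj_on_subset[OF inj SX]] by (simp add: insets_def)
    moreover have "\<forall>i\<in>{1..n}. f ` S \<inter> B' i \<noteq> {}"
    proof
      fix i assume i: "i \<in> {1..n}"
      have "S \<inter> B i \<noteq> {}" using S i by (simp add: insets_def)
      then obtain x where "x \<in> S" "x \<in> B i" by blast
      then have "f x \<in> f ` S \<inter> B' i" using im(1)[OF i] by blast
      then show "f ` S \<inter> B' i \<noteq> {}" by blast
    qed
    moreover have "f ` S \<subseteq> X'" using SX fX by blast
    ultimately show "f ` S \<in> insets B' Y' n k" by (simp add: insets_def X'_def)
  qed
  moreover have "finite (insets B' Y' n k)"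
  proof (rule finite_subset)
    show "insets B' Y' n k \<subseteq> Pow X'" by (auto simp: insets_def X'_def)
    show "finite (Pow X')"
      using fin P' by (auto simp: X'_def block_partition_def)
  qed
  ultimately show ?thesis by (metis card_inj_on_le)
qed

lemma card_insets:
  assumes "block_partition B Y m n"
  shows "card (insets B Y n k) = inset_number m n k"
  unfolding inset_number_def
  by (intro antisym card_insets_le[OF assms block_partition_model]
        card_insets_le[OF block_partition_model assms])

end

theory Submission imports Defs
begin

text \<open>Fix an element \<open>y\<close> of a nonempty \<open>Y\<close>. The insets avoiding \<open>y\<close> are the insets for the
  smaller set \<open>Y - {y}\<close>; those containing \<open>y\<close> arise from insets for \<open>Y - {y}\<close> with one element
  fewer, since \<open>y\<close> hits no block. This is a Pascal rule in \<open>m\<close> and \<open>k\<close>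
  (\<open>inset_number_Suc_Suc\<close>). Iterating it only on the term with the larger lower entry telescopes
  to the sum, as in the hockey-stick identity, and leaves the case \<open>m = 0\<close> as boundary term.

  For \<open>m = 0\<close> an inset takes one or two elements from each of the \<open>n\<close> blocks. It has \<open>n + k\<close>
  elements exactly when \<open>k\<close> blocks are contained in it, and each of the \<open>n - k\<close> other blocks
  then leaves a choice between two elements. Hence the boundary value is \<open>2 ^ (n - k)\<close> times
  \<open>n choose k\<close> (\<open>inset_number_0\<close>). In the theorem it enters with \<open>k + 1\<close> in place of \<open>k\<close>, so for
  \<open>n \<le> k\<close> it vanishes: \<open>n\<close> blocks cannot contribute \<open>k + 1\<close> full ones.\<close>

text \<open>Finiteness matters because an infinite set has cardinality \<open>0\<close>: for \<open>n = k = 0\<close> an infinite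
  subset of \<open>Y\<close> would count as an inset, and inserting \<open>y\<close> would not raise its size to \<open>1\<close>.\<close>

lemma insets_insert:
  assumes fin: "finite Y" "\<And>i. i \<in> {1..n} \<Longrightarrow> finite (B i)"
    and y: "y \<notin> Y" "\<And>i. i \<in> {1..n} \<Longrightarrow> y \<notin> B i"
  shows "insets B (insert y Y) n (Suc k) = insets B Y n (Suc k) \<union> insert y ` insets B Y n k"
proof (intro equalityI subsetI)
  fix S assume S: "S \<in> insets B (insert y Y) n (Suc k)"
  show "S \<in> insets B Y n (Suc k) \<union> insert y ` insets B Y n k"
  proof (cases "y \<in> S")
    case True
    have "S - {y} \<in> insets B Y n k"
      using S True y(2) by (fastforce simp: insets_def)
    moreover have "S = insert y (S - {y})"
      using True by blast
    ultimately show ?thesis by blast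
  next
    case False
    then show ?thesis using S by (auto simp: insets_def)
  qed
next
  fix S assume "S \<in> insets B Y n (Suc k) \<union> insert y ` insets B Y n k"
  then consider "S \<in> insets B Y n (Suc k)" | T where "T \<in> insets B Y n k" "S = insert y T"
    by blast
  then show "S \<in> insets B (insert y Y) n (Suc k)"
  proof cases
    case 1
    then show ?thesis by (auto simp: insets_def)
  next
    case (2 T)
    have T: "T \<subseteq> (\<Union>i\<in>{1..n}. B i) \<union> Y"
      using 2 by (simp add: insets_def)
    then have "finite T"
      using fin by (auto intro: finite_subset)
    moreover have "y \<notin> T"
      using T y by blast
    ultimately show ?thesis
      using 2 by (auto simp: insets_def)
  qed
qed

lemma inset_number_Suc_Suc:
  "inset_number (Suc m) n (Suc k) = inset_number m n (Suc k) + inset_number m n k"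
proof -
  define B where "B = (\<lambda>i::nat. {i} \<times> {..<2::nat})"
  define Y where "Y = {0::nat} \<times> {..<m}"
  define y where "y = (0::nat, m)"
  have Y': "{0::nat} \<times> {..<Suc m} = insert y Y"
    by (auto simp: y_def Y_def)
  have fin: "finite (insets B Y n j)" for j
    by (rule finite_subset[of _ "Pow ((\<Union>i\<in>{1..n}. B i) \<union> Y)"])
      (auto simp: insets_def B_def Y_def)
  have y: "y \<notin> S" if "S \<in> insets B Y n j" for S j
    using that by (auto simp: insets_def B_def Y_def y_def)
  have "insets B (insert y Y) n (Suc k) = insets B Y n (Suc k) \<union> insert y ` insets B Y n k"
    by (rule insets_insert) (auto simp: B_def Y_def y_def)
  moreover have "insets B Y n (Suc k) \<inter> insert y ` insets B Y n k = {}"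
    using y by blast
  moreover have "inj_on (insert y) (insets B Y n k)"
    using y by (meson inj_onI insert_ident)
  ultimately have "card (insets B (insert y Y) n (Suc k))
      = card (insets B Y n (Suc k)) + card (insets B Y n k)"
    using fin by (simp add: card_Un_disjoint card_image)
  then show ?thesis
    by (simp add: inset_number_def Y' flip: B_def Y_def)
qed

text \<open>An inset of \<open>n\<close> two-element blocks is encoded by the set \<open>K\<close> of blocks that it contains and
  the set \<open>T\<close> of blocks that it meets only in the first element.\<close>

lemma inset_number_0: "inset_number 0 n k = 2 ^ (n - k) * (n choose k)"
proof -
  define P where "P = (SIGMA K:{K. K \<subseteq> {1..n} \<and> card K = k}. Pow ({1..n} - K))"
  define Is where "Is = insets (\<lambda>i. {i} \<times> {..<2::nat}) ({0::nat} \<times> {..<0}) n k"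
  define dec where "dec = (\<lambda>(K, T). (K \<union> T) \<times> {0::nat} \<union> ({1..n} - T) \<times> {1::nat})"
  define enc where "enc S = ({i. (i, 0) \<in> S \<and> (i, 1) \<in> S}, {i. (i, 0) \<in> S \<and> (i, 1) \<notin> S})"
    for S :: "(nat \<times> nat) set"
  have card_dec: "card (dec (K, T)) = n + card K" if "K \<subseteq> {1..n}" "T \<subseteq> {1..n} - K" for K T
  proof -
    have fin: "finite K" "finite T"
      using that by (auto intro: finite_subset)
    have "card (dec (K, T)) = card (K \<union> T) + card ({1..n} - T)"
      unfolding dec_def prod.case using fin
      by (subst card_Un_disjoint) (auto simp: card_cartesian_product)
    also have "card (K \<union> T) = card K + card T"
      using fin that by (intro card_Un_disjoint) auto
    also have "card ({1..n} - T) = n - card T"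
      using fin that by (subst card_Diff_subset) auto
    also have "card T \<le> n"
      using card_mono[of "{1..n}" T] that by auto
    then have "card K + card T + (n - card T) = n + card K"
      by simp
    finally show ?thesis .
  qed
  have two: "{..<2::nat} = {0, 1}"
    by auto
  have dec_enc: "dec (enc S) = S" if "S \<in> Is" for S
  proof -
    have S: "S \<subseteq> {1..n} \<times> {0, 1}" "\<And>i. i \<in> {1..n} \<Longrightarrow> (i, 0) \<in> S \<or> (i, 1) \<in> S"
      using that by (fastforce simp: Is_def insets_def two)+
    show ?thesis
    proof (rule set_eqI)
      fix x :: "nat \<times> nat"
      show "x \<in> dec (enc S) \<longleftrightarrow> x \<in> S"
        using S by (cases x) (auto simp: dec_def enc_def)
    qed
  qed
  have "bij_betw dec P Is"
  proof (rule bij_betw_byWitness[where f' = enc])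
    show "\<forall>p\<in>P. enc (dec p) = p"
      by (auto simp: P_def enc_def dec_def)
    show "\<forall>S\<in>Is. dec (enc S) = S"
      using dec_enc by blast
    show "dec ` P \<subseteq> Is"
    proof (rule image_subsetI)
      fix p assume "p \<in> P"
      then obtain K T where p: "p = (K, T)" "K \<subseteq> {1..n}" "card K = k" "T \<subseteq> {1..n} - K"
        by (auto simp: P_def)
      have "dec p \<subseteq> (\<Union>i\<in>{1..n}. {i} \<times> {..<2::nat})"
        using p by (auto simp: dec_def)
      moreover have "dec p \<inter> {i} \<times> {..<2::nat} \<noteq> {}" if "i \<in> {1..n}" for i
      proof -
        have "(i, if i \<in> T then 0 else 1) \<in> dec p \<inter> {i} \<times> {..<2::nat}"
          using that p(1) by (simp add: dec_def)
        then show ?thesis by blast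
      qed
      ultimately show "dec p \<in> Is"
        using card_dec p by (simp add: Is_def insets_def)
    qed
    show "enc ` Is \<subseteq> P"
    proof (rule image_subsetI)
      fix S assume S: "S \<in> Is"
      obtain K T where KT: "enc S = (K, T)"
        by fastforce
      have "S \<subseteq> {1..n} \<times> {0, 1}"
        using S by (fastforce simp: Is_def insets_def two)
      then have "K \<subseteq> {1..n}" "T \<subseteq> {1..n} - K"
        using KT by (auto simp: enc_def)
      moreover from this have "card S = n + card K"
        using card_dec[of K T] dec_enc[OF S] KT by simp
      moreover from this have "card K = k"
        using S by (simp add: Is_def insets_def)
      ultimately show "enc S \<in> P"
        by (simp add: P_def KT)
    qed
  qed
  then have "inset_number 0 n k = card P"
    unfolding inset_number_def Is_def[symmetric] by (rule bij_betw_same_card[symmetric])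
  also have "card P = (\<Sum>K | K \<subseteq> {1..n} \<and> card K = k. card (Pow ({1..n} - K)))"
    unfolding P_def by (rule card_SigmaI) auto
  also have "\<dots> = (\<Sum>K | K \<subseteq> {1..n} \<and> card K = k. 2 ^ (n - k))"
    by (rule sum.cong) (auto simp: card_Pow card_Diff_subset finite_subset)
  also have "\<dots> = 2 ^ (n - k) * (n choose k)"
    by (simp add: n_subsets)
  finally show ?thesis .
qed

theorem proposition2:
  fixes m n k :: nat
  shows "inset_number (m + 1) n (k + 1)
           = 2 ^ (n - k - 1) * (n choose (k + 1)) + (\<Sum>i = 0..m. inset_number i n k)
       \<and> (n \<le> k \<and> k \<le> m + n \<longrightarrow>
           inset_number (m + 1) n (k + 1) = (\<Sum>i = 0..m. inset_number i n k))"
proof -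
  have "inset_number (m + 1) n (k + 1)
      = inset_number 0 n (k + 1) + (\<Sum>i = 0..m. inset_number i n k)"
    by (induction m) (simp_all add: inset_number_Suc_Suc)
  then have "inset_number (m + 1) n (k + 1)
      = 2 ^ (n - k - 1) * (n choose (k + 1)) + (\<Sum>i = 0..m. inset_number i n k)"
    by (simp add: inset_number_0)
  moreover have "n choose (k + 1) = 0" if "n \<le> k"
    using that by simp
  ultimately show ?thesis
    by simp
qed

end
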